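(* Let $0<a<b<1$, let $\psi$ be a homeomorphism from $[0,a]$ onto itself, let $\phi$ be a homeomorphism from $[0,a]$ onto $[b,1]$, and let $f:[0,a]\to[0,a]$ be a continuous map. Let $\Psi_a(f):[0,1]\to[0,1]$ be a continuous map such that $$(\Psi_a(f))(x)=\begin{cases}\phi(f(\psi(x))), & 0\le x\le a,\\ (\psi^{-1}\circ\phi^{-1})(x), & b\le x\le 1,\end{cases}$$ and $\Psi_a(f)$ is decreasing on $[a,b]$. Then, for each $n\ge 1$, a point $x_0\in[0,a]$ is a period-$(2n)$ point of $\Psi_a(f)$ if and only if $\psi(x_0)$ is a period-$n$ point of $f$. Moreover, $$\{m : \Psi_a(f)\text{ has a period-}m\text{ point in }[0,1]\}=\{2n : f\text{ has a period-}n\text{ point in }[0,a]\}\cup\{1\}.$$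
   Context: For a continuous map $g$ of a compact interval into itself and $n\ge1$, $g^n$ denotes the $n$-th iterate. A period-$n$ point of $g$ is a point $x_0$ with $g^n(x_0)=x_0$ and $g^i(x_0)\neq x_0$ for $0<i<n$ (i.e. $n$ is the least period); in particular a period-1 point is a fixed point. *)

theory Defs
  imports "HOL-Analysis.Analysis"
begin

definition is_period_point :: "'a set \<Rightarrow> ('a \<Rightarrow> 'a) \<Rightarrow> nat \<Rightarrow> 'a \<Rightarrow> bool" where
  "is_period_point I g n x \<longleftrightarrow>
     1 \<le> n \<and> x \<in> I \<and> (g ^^ n) x = x \<and> (\<forall>i. 0 < i \<and> i < n \<longrightarrow> (g ^^ i) x \<noteq> x)"

end

theory Submission
  imports Defs
begin

text \<open>Write \<open>G\<close> for the map \<open>\<Psi>\<^sub>a(f)\<close>, \<open>A = [0,a]\<close> and \<open>B = [b,1]\<close>. The map \<open>G\<close> exchanges the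
  disjoint sets \<open>A\<close> and \<open>B\<close>, and its square restricted to \<open>A\<close> is \<open>\<psi>\<^sup>-\<^sup>1 \<circ> f \<circ> \<psi>\<close>, a conjugate of \<open>f\<close>.
  Hence a point of \<open>A\<close> returns to itself only after an even number \<open>2n\<close> of steps, and it does so
  exactly when \<open>f\<^sup>n\<close> fixes its image under \<open>\<psi>\<close> (\<open>swap_funpow_fixed_iff\<close>). This is the first
  claim.

  For the set of periods, a periodic orbit that meets \<open>A \<union> B\<close> contains a point of \<open>A\<close> and is
  accounted for by the first claim. Any other periodic orbit stays in the middle interval, where
  \<open>G\<close> is decreasing; there \<open>G\<^sup>2\<close> is increasing, and a periodic point of an increasing map is fixed,
  so the period is 1 or 2 (\<open>antimono_funpow_periodic\<close>). Such a 2-cycle in the middle contributes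
  no new period, because \<open>f\<close> has a fixed point in \<open>A\<close> and \<open>2 = 2 \<cdot> 1\<close> is already on the list.
  Finally, period 1 always occurs, since \<open>G\<close> is a continuous
  map of the compact interval \<open>[0,1]\<close> into itself.\<close>

section \<open>Periodic points\<close>

lemma funpow_mem:
  assumes "g \<in> X \<rightarrow> X" "x \<in> X"
  shows "(g ^^ n) x \<in> X"
  using assms by (induction n) auto

lemma is_period_point_image:
  assumes g: "g \<in> X \<rightarrow> X" and x: "is_period_point X g m x"
  shows "is_period_point X g m (g x)"
proof -
  have m: "1 \<le> m" and xX: "x \<in> X" and gm: "(g ^^ m) x = x"
    and least: "\<And>i. 0 < i \<Longrightarrow> i < m \<Longrightarrow> (g ^^ i) x \<noteq> x"
    using x by (auto simp: is_period_point_def)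
  have "(g ^^ i) (g x) \<noteq> g x" if i: "0 < i" "i < m" for i
  proof
    assume eq: "(g ^^ i) (g x) = g x"
    \<comment> \<open>On the cycle, \<open>g\<^sup>m\<^sup>-\<^sup>1\<close> is the inverse of \<open>g\<close>, so it carries the early return of \<open>g x\<close> back to \<open>x\<close>.\<close>
    have inverse: "(g ^^ (m - 1)) (g x) = x"
      using gm m by (cases m) (simp_all add: funpow_swap1)
    have "(g ^^ i) x = (g ^^ i) ((g ^^ (m - 1)) (g x))"
      by (simp only: inverse)
    also have "\<dots> = (g ^^ (m - 1)) ((g ^^ i) (g x))"
      by (metis add.commute comp_apply funpow_add)
    also have "\<dots> = x"
      by (simp only: eq inverse)
    finally show False
      using least[OF i] by simp
  qed
  moreover have "(g ^^ m) (g x) = g x"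
    using gm by (simp flip: funpow_swap1)
  ultimately show ?thesis
    using m xX g by (auto simp: is_period_point_def)
qed

text \<open>The square of a decreasing map is increasing, so the points \<open>x, g\<^sup>2 x, g\<^sup>4 x, \<dots>\<close> form a monotone
  sequence; as it returns to \<open>x\<close>, it is constant.\<close>

lemma antimono_funpow_periodic:
  fixes g :: "'a :: linorder \<Rightarrow> 'a"
  assumes anti: "antimono_on S g" and orbit: "\<And>i. (g ^^ i) x \<in> S"
    and m: "0 < m" and fixed: "(g ^^ m) x = x"
  shows "g (g x) = x"
proof -
  define u where "u k = (g ^^ (2 * k)) x" for k
  have u_Suc: "u (Suc k) = g (g (u k))" for k
    by (simp add: u_def)
  have mono: "g (g y) \<le> g (g z)"
    if "y \<le> z" "y \<in> S" "z \<in> S" "g y \<in> S" "g z \<in> S" for y z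
    using that anti by (auto simp: monotone_on_def)
  have uS: "u k \<in> S" "g (u k) \<in> S" for k
    using orbit[of "2 * k"] orbit[of "Suc (2 * k)"] by (simp_all add: u_def)
  have u0: "u 0 = x"
    by (simp add: u_def)
  have um: "u m = x"
    using fixed by (simp add: u_def mult_2 funpow_add)
  have le: "u 1 \<le> u m \<and> u 0 \<le> u 1" if "u 0 \<le> u 1"
  proof -
    have "u k \<le> u (Suc k)" for k
    proof (induction k)
      case (Suc k)
      then show ?case
        using mono[OF _ uS(1) uS(1) uS(2) uS(2)] u_Suc by metis
    qed (use that in simp)
    then show ?thesis
      using m lift_Suc_mono_le[of u 1 m] that by simp
  qed
  have ge: "u m \<le> u 1 \<and> u 1 \<le> u 0" if "u 1 \<le> u 0"
  proof -
    have "u (Suc k) \<le> u k" for k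
    proof (induction k)
      case (Suc k)
      then show ?case
        using mono[OF _ uS(1) uS(1) uS(2) uS(2)] u_Suc by metis
    qed (use that in simp)
    then show ?thesis
      using m lift_Suc_antimono_le[of u 1 m] that by simp
  qed
  have "u 1 = x"
    using le ge u0 um by (metis linorder_linear order_antisym)
  then show ?thesis
    using u_Suc[of 0] u0 by simp
qed

section \<open>A square root of a conjugate map on two exchanged sets\<close>

lemma swap_funpow_double:
  assumes \<psi>: "homeomorphism A A \<psi> \<psi>'" and \<phi>: "homeomorphism A B \<phi> \<phi>'" and f: "f \<in> A \<rightarrow> A"
    and GA: "\<And>x. x \<in> A \<Longrightarrow> G x = \<phi> (f (\<psi> x))"
    and GB: "\<And>x. x \<in> B \<Longrightarrow> G x = \<psi>' (\<phi>' x)"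
    and x: "x \<in> A"
  shows "(G ^^ (2 * n)) x = \<psi>' ((f ^^ n) (\<psi> x))"
proof (induction n)
  case 0
  show ?case
    using homeomorphism_apply1[OF \<psi> x] by simp
next
  case (Suc n)
  define y where "y = (f ^^ n) (\<psi> x)"
  have "\<psi> x \<in> A"
    using x homeomorphism_image1[OF \<psi>] by blast
  then have y: "y \<in> A"
    unfolding y_def by (rule funpow_mem[OF f])
  then have fy: "f y \<in> A" and y': "\<psi>' y \<in> A"
    using f homeomorphism_image2[OF \<psi>] by blast+
  have "\<phi> (f y) \<in> B"
    using fy homeomorphism_image1[OF \<phi>] by blast
  then have "G (G (\<psi>' y)) = \<psi>' (f y)"
    by (simp add: GA GB y' y fy homeomorphism_apply2[OF \<psi>] homeomorphism_apply1[OF \<phi>])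
  then show ?case
    using Suc by (simp add: y_def)
qed

lemma swap_funpow_fixed_iff:
  assumes \<psi>: "homeomorphism A A \<psi> \<psi>'" and \<phi>: "homeomorphism A B \<phi> \<phi>'" and f: "f \<in> A \<rightarrow> A"
    and GA: "\<And>x. x \<in> A \<Longrightarrow> G x = \<phi> (f (\<psi> x))"
    and GB: "\<And>x. x \<in> B \<Longrightarrow> G x = \<psi>' (\<phi>' x)"
    and disj: "A \<inter> B = {}" and x: "x \<in> A"
  shows "(G ^^ m) x = x \<longleftrightarrow> even m \<and> (f ^^ (m div 2)) (\<psi> x) = \<psi> x"
proof -
  note double = swap_funpow_double[OF \<psi> \<phi> f GA GB x]
  have \<psi>x: "\<psi> x \<in> A"
    using x homeomorphism_image1[OF \<psi>] by blast
  have fA: "(f ^^ n) (\<psi> x) \<in> A" for n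
    using funpow_mem[OF f \<psi>x] .
  show ?thesis
  proof (cases "even m")
    case True
    then have "(G ^^ m) x = \<psi>' ((f ^^ (m div 2)) (\<psi> x))"
      using double[of "m div 2"] by simp
    then show ?thesis
      using True homeomorphism_apply2[OF \<psi> fA] homeomorphism_apply1[OF \<psi> x] by metis
  next
    case False
    \<comment> \<open>After an odd number of steps the orbit of \<open>x\<close> is in \<open>B\<close>.\<close>
    then obtain n where n: "m = Suc (2 * n)"
      using oddE by fastforce
    have "\<psi>' ((f ^^ n) (\<psi> x)) \<in> A"
      using fA homeomorphism_image2[OF \<psi>] by blast
    then have "(G ^^ m) x = \<phi> (f ((f ^^ n) (\<psi> x)))"
      using double[of n] GA homeomorphism_apply2[OF \<psi> fA] by (simp add: n)
    moreover have "\<phi> (f ((f ^^ n) (\<psi> x))) \<in> B"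
      using fA[of n] f homeomorphism_image1[OF \<phi>] by blast
    ultimately show ?thesis
      using False x disj by auto
  qed
qed

lemma swap_period_point_iff:
  assumes "homeomorphism A A \<psi> \<psi>'" and "homeomorphism A B \<phi> \<phi>'" and "f \<in> A \<rightarrow> A"
    and "\<And>x. x \<in> A \<Longrightarrow> G x = \<phi> (f (\<psi> x))"
    and "\<And>x. x \<in> B \<Longrightarrow> G x = \<psi>' (\<phi>' x)"
    and "A \<inter> B = {}" and x: "x \<in> A" and "A \<subseteq> X"
  shows "is_period_point X G m x \<longleftrightarrow> even m \<and> is_period_point A f (m div 2) (\<psi> x)"
proof -
  note fixed_iff = swap_funpow_fixed_iff[OF assms(1-7)]
  have xX: "x \<in> X" and \<psi>x: "\<psi> x \<in> A"
    using assms(8) x homeomorphism_image1[OF assms(1)] by blast+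
  have "(\<forall>i. 0 < i \<and> i < m \<longrightarrow> \<not> (even i \<and> (f ^^ (i div 2)) (\<psi> x) = \<psi> x)) \<longleftrightarrow>
        (\<forall>i. 0 < i \<and> i < m div 2 \<longrightarrow> (f ^^ i) (\<psi> x) \<noteq> \<psi> x)" (is "?L \<longleftrightarrow> ?R") if "even m"
  proof
    show ?R if L: ?L
    proof (intro allI impI)
      fix i assume "0 < i \<and> i < m div 2"
      then show "(f ^^ i) (\<psi> x) \<noteq> \<psi> x"
        using L[rule_format, of "2 * i"] \<open>even m\<close> by (auto elim!: evenE)
    qed
    show ?L if ?R
      using that \<open>even m\<close> by (auto elim!: evenE)
  qed
  then show ?thesis
    using xX \<psi>x by (auto simp: is_period_point_def fixed_iff elim!: evenE)
qed

section \<open>The periods of the extended map\<close>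

theorem mainTheorem2:
  fixes a b :: real
    and \<psi> \<psi>' \<phi> \<phi>' f \<Psi>f :: "real \<Rightarrow> real"
  assumes "0 < a" and "a < b" and "b < 1"
    and "homeomorphism {0..a} {0..a} \<psi> \<psi>'"
    and "homeomorphism {0..a} {b..1} \<phi> \<phi>'"
    and "continuous_on {0..a} f" and "f \<in> {0..a} \<rightarrow> {0..a}"
    and "continuous_on {0..1} \<Psi>f" and "\<Psi>f \<in> {0..1} \<rightarrow> {0..1}"
    and "\<And>x. x \<in> {0..a} \<Longrightarrow> \<Psi>f x = \<phi> (f (\<psi> x))"
    and "\<And>x. x \<in> {b..1} \<Longrightarrow> \<Psi>f x = (\<psi>' \<circ> \<phi>') x"
    and "antimono_on {a..b} \<Psi>f"
  shows "(\<forall>n\<ge>1. \<forall>x0\<in>{0..a}.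
            is_period_point {0..1} \<Psi>f (2 * n) x0 \<longleftrightarrow> is_period_point {0..a} f n (\<psi> x0))
       \<and> {m. \<exists>x. is_period_point {0..1} \<Psi>f m x}
           = {2 * n |n. \<exists>x. is_period_point {0..a} f n x} \<union> {1}"
proof -
  note \<psi> = assms(4) and \<phi> = assms(5)
  have GB: "\<Psi>f x = \<psi>' (\<phi>' x)" if "x \<in> {b..1}" for x
    using assms(11)[OF that] by simp
  have disj: "{0..a} \<inter> {b..1} = {}" and sub: "{0..a} \<subseteq> {0..1}"
    using assms(1-3) by auto
  have iff: "is_period_point {0..1} \<Psi>f m x \<longleftrightarrow> even m \<and> is_period_point {0..a} f (m div 2) (\<psi> x)"
    if "x \<in> {0..a}" for m x
    by (rule swap_period_point_iff[OF \<psi> \<phi> assms(7) assms(10) GB disj that sub])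
  have A_to_B: "\<Psi>f x \<in> {b..1}" if x: "x \<in> {0..a}" for x
  proof -
    have "\<psi> x \<in> {0..a}"
      using x homeomorphism_image1[OF \<psi>] by blast
    then have "f (\<psi> x) \<in> {0..a}"
      using assms(7) by (rule funcset_mem[rotated])
    then have "\<phi> (f (\<psi> x)) \<in> {b..1}"
      using homeomorphism_image1[OF \<phi>] by blast
    then show ?thesis
      using assms(10)[OF x] by simp
  qed
  have B_to_A: "\<Psi>f x \<in> {0..a}" if x: "x \<in> {b..1}" for x
  proof -
    have "\<phi>' x \<in> {0..a}"
      using x homeomorphism_image2[OF \<phi>] by blast
    then have "\<psi>' (\<phi>' x) \<in> {0..a}"
      using homeomorphism_image2[OF \<psi>] by blast
    then show ?thesis
      using GB[OF x] by simp
  qed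
  have double: "is_period_point {0..1} \<Psi>f (2 * n) x0 \<longleftrightarrow> is_period_point {0..a} f n (\<psi> x0)"
    if "x0 \<in> {0..a}" for n x0
    using iff[OF that, of "2 * n"] by simp
  have fix_f: "\<exists>x. is_period_point {0..a} f 1 x"
  proof -
    have "\<exists>x\<in>{0..a}. f x = x"
      using brouwer[of "{0..a}" f] assms(1,6,7) by (metis atLeastatMost_empty_iff2 compact_Icc convex_real_interval(5) less_imp_le not_le zero_less_one)
    then show ?thesis
      by (auto simp: is_period_point_def)
  qed
  have fix_G: "\<exists>x. is_period_point {0..1} \<Psi>f 1 x"
  proof -
    have "\<exists>x\<in>{0..1}. \<Psi>f x = x"
      using brouwer[of "{0..1}" \<Psi>f] assms(8,9) by (metis atLeastatMost_empty_iff2 compact_Icc convex_real_interval(5) less_imp_le not_le zero_less_one)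
    then show ?thesis
      by (auto simp: is_period_point_def)
  qed
  have periods_G: "m = 1 \<or> (\<exists>n. m = 2 * n \<and> (\<exists>y. is_period_point {0..a} f n y))"
    if x: "is_period_point {0..1} \<Psi>f m x" for m x
  proof -
    have from_A: ?thesis if "is_period_point {0..1} \<Psi>f m z" "z \<in> {0..a}" for z
      using iff[OF that(2), of m] that(1) by (metis dvd_mult_div_cancel)
    have from_AB: ?thesis if "is_period_point {0..1} \<Psi>f m z" "z \<in> {0..a} \<union> {b..1}" for z
      using that from_A is_period_point_image[OF assms(9) that(1)] B_to_A by blast
    have orbit: "is_period_point {0..1} \<Psi>f m ((\<Psi>f ^^ i) x)" for i
      using x by (induction i) (auto intro: is_period_point_image[OF assms(9)])
    show ?thesis
    proof (cases "\<exists>i. (\<Psi>f ^^ i) x \<in> {0..a} \<union> {b..1}")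
      case True
      then show ?thesis
        using orbit from_AB by blast
    next
      case False
      have "(\<Psi>f ^^ i) x \<in> {a..b}" for i
      proof -
        have "(\<Psi>f ^^ i) x \<in> {0..1}"
          using orbit[of i] by (simp add: is_period_point_def)
        moreover have "(\<Psi>f ^^ i) x \<notin> {0..a}" "(\<Psi>f ^^ i) x \<notin> {b..1}"
          using False by blast+
        ultimately show ?thesis
          by auto
      qed
      then have "\<Psi>f (\<Psi>f x) = x"
        using antimono_funpow_periodic[OF assms(12), of x m] x
        by (simp add: is_period_point_def)
      then have "(\<Psi>f ^^ 2) x = x"
        by (simp add: numeral_2_eq_2)
      then have "\<not> 2 < m" and "1 \<le> m"
        using x unfolding is_period_point_def by (metis pos2, blast)
      then have "m = 1 \<or> m = 2"
        by linarith
      \<comment> \<open>A 2-cycle in the middle may exist; its period is also realised by a fixed point of \<open>f\<close>.\<close>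
      then show ?thesis
        using fix_f by (metis mult.right_neutral)
    qed
  qed
  have periods_f: "\<exists>x. is_period_point {0..1} \<Psi>f (2 * n) x"
    if y: "is_period_point {0..a} f n y" for n y
  proof -
    have "y \<in> {0..a}"
      using y by (simp add: is_period_point_def)
    then have "\<psi>' y \<in> {0..a}" "\<psi> (\<psi>' y) = y"
      using homeomorphism_image2[OF \<psi>] homeomorphism_apply2[OF \<psi>] by blast+
    then show ?thesis
      using double[of "\<psi>' y" n] y by auto
  qed
  have "{m. \<exists>x. is_period_point {0..1} \<Psi>f m x}
      = {2 * n |n. \<exists>x. is_period_point {0..a} f n x} \<union> {1}"
    (is "?P = ?Q")
  proof
    show "?P \<subseteq> ?Q"
      using periods_G by blast
    show "?Q \<subseteq> ?P"
    proof
      fix m assume "m \<in> ?Q"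
      then consider "m = 1" | n y where "m = 2 * n" "is_period_point {0..a} f n y"
        by blast
      then show "m \<in> ?P"
        by cases (use fix_G periods_f in \<open>simp_all\<close>)
    qed
  qed
  then show ?thesis
    using double by (intro conjI ballI allI impI)
qed

end
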